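(* Let $K$ and $L$ be simplicial complexes (geometric or abstract) with disjoint vertex sets whose join $K \ast L$ exists, and let $M$ be a subcomplex of $K \ast L$. Let $p, q \geq 0$ and let $\alpha \in \tilde{H}_{p}(K; \mathbb{Z}/2)$ and $\beta \in \tilde{H}_{q}(L; \mathbb{Z}/2)$ be non-trivial (nonzero) classes. Let $w$ and $z$ be cycles (with $\mathbb{Z}/2$ coefficients) representing $\alpha$ and $\beta$, respectively. Suppose that the join chain $w \ast z$ lies in $C_{p+q+1}(M) \otimes \mathbb{Z}/2$ and that $w \ast z$ represents a non-trivial class in $\tilde{H}_{p+q+1}(M; \mathbb{Z}/2)$. Let $i : \mathcal{C}(M) \otimes \mathbb{Z}/2 \to \mathcal{C}(K \ast L) \otimes \mathbb{Z}/2$ be the inclusion. Then $i(w \ast z)$ represents a non-trivial class in $\tilde{H}_{p+q+1}(K \ast L; \mathbb{Z}/2)$.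
   Context: For simplices $\sigma \in K$ and $\tau \in L$, $\sigma \ast \tau$ denotes the simplex whose vertex set is the union of the vertices of $\sigma$ and the vertices of $\tau$; so $\dim(\sigma \ast \tau) = \dim \sigma + \dim \tau + 1$. The join $K \ast L$ is the simplicial complex consisting of all $\sigma \ast \tau$ with $\sigma \in K$, $\tau \in L$, and all faces of such; in particular, the simplices of $K$ and of $L$ belong to $K \ast L$. In the geometric case, the existence of the join includes the assumption that for all $\sigma \in K$ and $\tau \in L$ the vertices of $\sigma$ together with those of $\tau$ are geometrically (affinely) independent. In the abstract case, the join always exists when the vertex sets are disjoint. For a simplicial complex $X$, $\mathcal{C}(X)$ denotes the augmented integer simplicial chain complex of $X$ (with $C_{-1}(X) = \mathbb{Z}$), and $\tilde{H}_{\ast}(X; \mathbb{Z}/2)$ denotes reduced homology, i.e. the homology of $\mathcal{C}(X) \otimes \mathbb{Z}/2$. If $c = \sigma_{1} + \cdots + \sigma_{m}$ is a $p$-chain in $\mathcal{C}(K) \otimes \mathbb{Z}/2$ and $d = \tau_{1} + \cdots + \tau_{n}$ is a $q$-chain in $\mathcal{C}(L) \otimes \mathbb{Z}/2$ ($p, q \geq 0$; the $\sigma_i$ are $p$-simplices of $K$, the $\tau_j$ are $q$-simplices of $L$), then $c \ast d$ is the $(p+q+1)$-chain $\sum_{i=1}^{m} \sum_{j=1}^{n} \sigma_{i} \ast \tau_{j}$ of $K \ast L$ with $\mathbb{Z}/2$ coefficients. If $c$ and $d$ are cycles, then so is $c \ast d$. *)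

theory Defs
  imports "HOL-Analysis.Analysis" "HOL-Algebra.Free_Abelian_Groups" "HOL-Library.Z2" "HOL-Library.Poly_Mapping"
begin

section \<open>Simplicial complexes and joins\<close>

text \<open>The empty simplex is not a member of a complex; complexes need not be finite.\<close>

definition abstract_complex :: "'a set set \<Rightarrow> bool" where
  "abstract_complex K \<longleftrightarrow>
     (\<forall>\<sigma>\<in>K. finite \<sigma> \<and> \<sigma> \<noteq> {}) \<and>
     (\<forall>\<sigma>\<in>K. \<forall>\<rho>. \<rho> \<subseteq> \<sigma> \<and> \<rho> \<noteq> {} \<longrightarrow> \<rho> \<in> K)"

text \<open>The simplices of \<open>K\<close> and \<open>L\<close> are listed separately, so that they belong to the join
  even when the other complex is empty; otherwise they are already faces of some \<open>\<sigma> \<union> \<tau>\<close>.\<close>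

definition complex_join :: "'a set set \<Rightarrow> 'a set set \<Rightarrow> 'a set set" where
  "complex_join K L = K \<union> L \<union> {\<rho>. \<rho> \<noteq> {} \<and> (\<exists>\<sigma>\<in>K. \<exists>\<tau>\<in>L. \<rho> \<subseteq> \<sigma> \<union> \<tau>)}"

text \<open>The members of a geometric complex are the simplices themselves, as point sets in a real
  vector space. The library predicate \<open>simplicial_complex\<close> is the analogous notion for finite
  complexes in a Euclidean space, with the empty face included.\<close>

definition geometric_complex :: "'a::real_vector set set \<Rightarrow> bool" where
  "geometric_complex K \<longleftrightarrow>
     (\<forall>S\<in>K. \<exists>V. finite V \<and> V \<noteq> {} \<and> \<not> affine_dependent V \<and> S = convex hull V) \<and>
     (\<forall>S\<in>K. \<forall>F. F face_of S \<and> F \<noteq> {} \<longrightarrow> F \<in> K) \<and>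
     (\<forall>S\<in>K. \<forall>T\<in>K. (S \<inter> T) face_of S)"

definition vertices :: "'a::real_vector set \<Rightarrow> 'a set" where
  "vertices S = {v. v extreme_point_of S}"

definition vertex_scheme :: "'a::real_vector set set \<Rightarrow> 'a set set" where
  "vertex_scheme K = vertices ` K"

definition geometric_join :: "'a::real_vector set set \<Rightarrow> 'a set set \<Rightarrow> 'a set set" where
  "geometric_join K L = (\<lambda>\<rho>. convex hull \<rho>) ` complex_join (vertex_scheme K) (vertex_scheme L)"

definition geometric_join_exists :: "'a::real_vector set set \<Rightarrow> 'a set set \<Rightarrow> bool" where
  "geometric_join_exists K L \<longleftrightarrow>
     (\<forall>S\<in>K. \<forall>T\<in>L. \<not> affine_dependent (vertices S \<union> vertices T)) \<and>
     geometric_complex (geometric_join K L)"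


section \<open>Reduced simplicial homology modulo 2\<close>

text \<open>A chain is a finite formal sum of simplices with coefficients in the field \<open>bit\<close> of two
  elements. This is the augmented integral chain complex tensored with \<open>\<int>/2\<close>: orientations play no
  role modulo 2, and the group in degree \<open>-1\<close> is spanned by the empty simplex, so that the
  augmentation is the boundary in degree \<open>0\<close>. For a geometric complex, all of this is applied to
  its vertex scheme.\<close>

type_synonym 'a mod2_chain = "'a set \<Rightarrow>\<^sub>0 bit"

definition simplices :: "'a set set \<Rightarrow> int \<Rightarrow> 'a set set" where
  "simplices X p = {\<sigma> \<in> insert {} X. int (card \<sigma>) = p + 1}"

definition chain_group :: "'a set set \<Rightarrow> int \<Rightarrow> 'a mod2_chain monoid" where
  "chain_group X p =
     \<lparr>carrier = {c. Poly_Mapping.keys c \<subseteq> simplices X p}, monoid.mult = (+), one = 0\<rparr>"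

text \<open>A chain modulo 2 is the formal sum of its keys.\<close>

definition boundary :: "'a mod2_chain \<Rightarrow> 'a mod2_chain" where
  "boundary c = (\<Sum>\<sigma>\<in>Poly_Mapping.keys c. \<Sum>v\<in>\<sigma>. Poly_Mapping.single (\<sigma> - {v}) 1)"

definition cycles :: "'a set set \<Rightarrow> int \<Rightarrow> 'a mod2_chain set" where
  "cycles X p = {c \<in> carrier (chain_group X p). boundary c = 0}"

definition boundaries :: "'a set set \<Rightarrow> int \<Rightarrow> 'a mod2_chain set" where
  "boundaries X p = boundary ` carrier (chain_group X (p + 1))"

definition reduced_homology :: "'a set set \<Rightarrow> int \<Rightarrow> 'a mod2_chain set monoid" where
  "reduced_homology X p = subgroup_generated (chain_group X p) (cycles X p) Mod boundaries X p"

definition represents :: "'a set set \<Rightarrow> int \<Rightarrow> 'a mod2_chain \<Rightarrow> 'a mod2_chain set \<Rightarrow> bool" where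
  "represents X p c \<gamma> \<longleftrightarrow>
     c \<in> cycles X p \<and> \<gamma> = boundaries X p #>\<^bsub>chain_group X p\<^esub> c"

definition represents_nontrivial :: "'a set set \<Rightarrow> int \<Rightarrow> 'a mod2_chain \<Rightarrow> bool" where
  "represents_nontrivial X p c \<longleftrightarrow>
     (\<exists>\<gamma> \<in> carrier (reduced_homology X p). \<gamma> \<noteq> \<one>\<^bsub>reduced_homology X p\<^esub> \<and> represents X p c \<gamma>)"

definition join_chain :: "'a mod2_chain \<Rightarrow> 'a mod2_chain \<Rightarrow> 'a mod2_chain" where
  "join_chain c d =
     (\<Sum>\<sigma>\<in>Poly_Mapping.keys c. \<Sum>\<tau>\<in>Poly_Mapping.keys d. Poly_Mapping.single (\<sigma> \<union> \<tau>) 1)"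

text \<open>The inclusion of the chains of a subcomplex \<open>M\<close> into those of any complex containing it;
  the larger complex does not enter, as both chain groups live in the same type.\<close>

definition chain_inclusion :: "'a set set \<Rightarrow> int \<Rightarrow> 'a mod2_chain \<Rightarrow> 'a mod2_chain" where
  "chain_inclusion M p = (\<lambda>c \<in> carrier (chain_group M p). c)"

end

theory Submission
  imports Defs
begin

text \<open>
  If \<open>w\<close> is not a boundary in \<open>K\<close> and \<open>z\<close> is not a boundary in \<open>L\<close>, then \<open>w * z\<close> is not a boundary in
  \<open>K * L\<close>. This is a part of the Kuenneth formula for joins over a field, and it gives the theorem, since a class is nontrivial exactly when a representing cycle is not a
  boundary, and since \<open>w * z\<close>, being a cycle of \<open>M\<close>, is also one of \<open>K * L\<close>.

  As the coefficients form a field, the subspace of boundaries in \<open>C\<^sub>q(L)\<close> can be separated from \<open>z\<close>: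
  some linear functional \<open>f\<close>, that is, a \<open>q\<close>-cocycle of \<open>L\<close>, vanishes on the boundaries and takes the
  value \<open>1\<close> on \<open>z\<close> (\<open>exists_separating_functional\<close>). Every simplex of \<open>K * L\<close> splits uniquely into its
  part \<open>\<sigma>\<close> in \<open>K\<close> and its part \<open>\<tau>\<close> in \<open>L\<close>, either of them possibly empty. Integrating the second part
  against \<open>f\<close>, that is, sending \<open>\<sigma> * \<tau>\<close> to \<open>f(\<tau>) \<sigma>\<close> if \<open>\<tau>\<close> has dimension \<open>q\<close> and to \<open>0\<close> otherwise,
  gives a map from the chains of \<open>K * L\<close> to those of \<open>K\<close> that lowers the dimension by \<open>q + 1\<close>. It
  commutes with the boundary: in \<open>\<partial>(\<sigma> * \<tau>) = \<partial>\<sigma> * \<tau> + \<sigma> * \<partial>\<tau>\<close> the second term goes to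
  \<open>f(\<partial>\<tau>) \<sigma> = 0\<close> (\<open>slice_boundary\<close>). It sends \<open>w * z\<close> to \<open>f(z) w = w\<close>. Hence a chain with
  boundary \<open>w * z\<close> would be sent to a chain of \<open>K\<close> with boundary \<open>w\<close> (\<open>join_chain_not_boundary\<close>).

  The geometric case is the abstract one for the vertex schemes. What has to be known is that
  taking vertices turns a geometric complex into an abstract one, and the geometric join into the
  abstract join. Both come from the fact that each subset of an affinely independent set spans
  a face of its convex hull.
\<close>

section \<open>Additive extension of maps on simplices\<close>

lemma chain_add_self: "x + x = 0" for x :: "'k \<Rightarrow>\<^sub>0 bit"
  by (rule poly_mapping_eqI) (simp add: lookup_add)

text \<open>Boundary and slicing are both sums over the simplices of a chain. Such a sum is additive in the
  chain only if each \<open>\<phi> \<sigma> + \<phi> \<sigma>\<close> vanishes, because a simplex common to two chains cancels in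
  their sum; the values used below are chains modulo 2.\<close>

definition additive_extension :: "('k \<Rightarrow> 'v::comm_monoid_add) \<Rightarrow> ('k \<Rightarrow>\<^sub>0 bit) \<Rightarrow> 'v" where
  "additive_extension \<phi> c = (\<Sum>\<sigma>\<in>Poly_Mapping.keys c. \<phi> \<sigma>)"

lemma additive_extension_single:
  "additive_extension \<phi> (Poly_Mapping.single \<sigma> b) = (if b = 0 then 0 else \<phi> \<sigma>)"
  by (simp add: additive_extension_def)

lemma additive_extension_zero: "additive_extension \<phi> 0 = 0"
  by (simp add: additive_extension_def)

lemma additive_extension_add:
  assumes "\<And>\<sigma>. \<phi> \<sigma> + \<phi> \<sigma> = 0"
  shows "additive_extension \<phi> (c + d) = additive_extension \<phi> c + additive_extension \<phi> d"
proof -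
  \<comment> \<open>The sum over the keys is rewritten as a sum of terms that are additive in the coefficients.\<close>
  define f where "f k b = (if b = 0 then 0 else \<phi> k)" for k and b :: bit
  have "f k (a + b) = f k a + f k b" for k and a b :: bit
    using assms[of k] by (cases a; cases b) (auto simp: f_def)
  then have "(\<Sum>k\<in>Poly_Mapping.keys (c + d). f k (Poly_Mapping.lookup (c + d) k)) =
      (\<Sum>k\<in>Poly_Mapping.keys c. f k (Poly_Mapping.lookup c k)) +
      (\<Sum>k\<in>Poly_Mapping.keys d. f k (Poly_Mapping.lookup d k))"
    by (intro setsum_keys_plus_distrib) (simp_all add: f_def)
  moreover have "(\<Sum>k\<in>Poly_Mapping.keys e. f k (Poly_Mapping.lookup e k)) = additive_extension \<phi> e" for e
    unfolding additive_extension_def by (rule sum.cong) (auto simp: f_def in_keys_iff)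
  ultimately show ?thesis by simp
qed

lemma additive_extension_sum:
  assumes "\<And>\<sigma>. \<phi> \<sigma> + \<phi> \<sigma> = 0"
  shows "additive_extension \<phi> (\<Sum>i\<in>I. c i) = (\<Sum>i\<in>I. additive_extension \<phi> (c i))"
  using sum_comp_morphism[of "additive_extension \<phi>" c I]
  by (simp add: additive_extension_zero additive_extension_add[OF assms] o_def)

lemma chain_eq_sum_of_keys:
  "(\<Sum>\<sigma>\<in>Poly_Mapping.keys c. Poly_Mapping.single \<sigma> 1) = c" for c :: "'k \<Rightarrow>\<^sub>0 bit"
proof (rule poly_mapping_eqI)
  fix k
  have "(\<Sum>\<sigma>\<in>Poly_Mapping.keys c. Poly_Mapping.lookup (Poly_Mapping.single \<sigma> (1 :: bit)) k) =
      (\<Sum>\<sigma>\<in>Poly_Mapping.keys c. if \<sigma> = k then 1 else 0)"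
    by (simp add: lookup_single when_def)
  also have "\<dots> = Poly_Mapping.lookup c k"
    by (simp add: in_keys_iff)
  finally show "Poly_Mapping.lookup (\<Sum>\<sigma>\<in>Poly_Mapping.keys c. Poly_Mapping.single \<sigma> 1) k = Poly_Mapping.lookup c k"
    by (simp add: lookup_sum)
qed

section \<open>Boundaries and nontrivial classes\<close>

lemma boundary_eq_extension:
  "boundary = additive_extension (\<lambda>\<sigma>. \<Sum>v\<in>\<sigma>. Poly_Mapping.single (\<sigma> - {v}) 1)"
  by (rule ext) (simp add: boundary_def additive_extension_def)

lemma boundary_single:
  "boundary (Poly_Mapping.single \<sigma> b) = (\<Sum>v\<in>\<sigma>. Poly_Mapping.single (\<sigma> - {v}) b)"
  by (simp add: boundary_eq_extension additive_extension_single)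

lemma boundary_zero: "boundary 0 = 0"
  by (simp add: boundary_eq_extension additive_extension_zero)

lemma boundary_add: "boundary (c + d) = boundary c + boundary d"
  unfolding boundary_eq_extension by (rule additive_extension_add) (rule chain_add_self)

lemma boundary_sum: "boundary (\<Sum>i\<in>I. c i) = (\<Sum>i\<in>I. boundary (c i))"
  unfolding boundary_eq_extension by (rule additive_extension_sum) (rule chain_add_self)

lemma zero_in_boundaries: "0 \<in> boundaries X p"
  unfolding boundaries_def chain_group_def by (rule image_eqI[of _ _ 0]) (simp_all add: boundary_zero)

lemma add_in_boundaries:
  assumes "b \<in> boundaries X p" "b' \<in> boundaries X p"
  shows "b + b' \<in> boundaries X p"
proof -
  obtain c c' where c: "b = boundary c" "Poly_Mapping.keys c \<subseteq> simplices X (p + 1)"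
    "b' = boundary c'" "Poly_Mapping.keys c' \<subseteq> simplices X (p + 1)"
    using assms by (auto simp: boundaries_def chain_group_def)
  show ?thesis
    unfolding boundaries_def chain_group_def
  proof (rule image_eqI)
    show "b + b' = boundary (c + c')" by (simp add: c boundary_add)
    show "c + c' \<in> carrier \<lparr>carrier = {c. Poly_Mapping.keys c \<subseteq> simplices X (p + 1)}, monoid.mult = (+), one = 0\<rparr>"
      using keys_add[of c c'] c by auto
  qed
qed

text \<open>The identity of the quotient is the set of boundaries itself. The coset of \<open>c\<close> contains \<open>c\<close>, so
  it can be that set only if \<open>c\<close> is a boundary; the converse is closure under addition.\<close>

lemma class_eq_one_iff:
  assumes "represents X p c \<gamma>"
  shows "\<gamma> = \<one>\<^bsub>reduced_homology X p\<^esub> \<longleftrightarrow> c \<in> boundaries X p"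
proof -
  have \<gamma>: "\<gamma> = (\<lambda>b. b + c) ` boundaries X p"
    using assms by (auto simp: represents_def r_coset_def chain_group_def)
  have one: "\<one>\<^bsub>reduced_homology X p\<^esub> = boundaries X p"
    by (simp add: reduced_homology_def FactGroup_def)
  show ?thesis
    unfolding one
  proof
    assume "\<gamma> = boundaries X p"
    moreover have "0 + c \<in> \<gamma>" unfolding \<gamma> by (rule imageI) (rule zero_in_boundaries)
    ultimately show "c \<in> boundaries X p" by simp
  next
    assume c: "c \<in> boundaries X p"
    show "\<gamma> = boundaries X p"
    proof
      show "\<gamma> \<subseteq> boundaries X p" using c by (auto simp: \<gamma> add_in_boundaries)
      show "boundaries X p \<subseteq> \<gamma>"
      proof
        fix b assume "b \<in> boundaries X p"
        then have "b + c \<in> boundaries X p" using c by (rule add_in_boundaries)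
        moreover have "b = (b + c) + c" by (simp add: add.assoc chain_add_self)
        ultimately show "b \<in> \<gamma>" unfolding \<gamma> by (rule image_eqI[rotated])
      qed
    qed
  qed
qed

text \<open>This reduces the theorem to a question about chains, in which no quotient groups occur.\<close>

lemma represents_nontrivial_iff:
  "represents_nontrivial X p c \<longleftrightarrow> c \<in> cycles X p \<and> c \<notin> boundaries X p"
proof
  assume "represents_nontrivial X p c"
  then show "c \<in> cycles X p \<and> c \<notin> boundaries X p"
    using class_eq_one_iff unfolding represents_nontrivial_def by (metis represents_def)
next
  assume c: "c \<in> cycles X p \<and> c \<notin> boundaries X p"
  define \<gamma> where "\<gamma> = boundaries X p #>\<^bsub>chain_group X p\<^esub> c"
  have rep: "represents X p c \<gamma>" using c by (simp add: represents_def \<gamma>_def)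
  have "c \<in> carrier (subgroup_generated (chain_group X p) (cycles X p))"
    unfolding carrier_subgroup_generated using c by (intro generate.incl) (simp add: cycles_def)
  then have "\<gamma> \<in> carrier (reduced_homology X p)"
    by (auto simp: reduced_homology_def FactGroup_def RCOSETS_def r_coset_def \<gamma>_def
        subgroup_generated_def)
  then show "represents_nontrivial X p c"
    using rep class_eq_one_iff[OF rep] c unfolding represents_nontrivial_def by blast
qed

lemma nontrivial_representative:
  assumes "represents X p c \<gamma>" "\<gamma> \<noteq> \<one>\<^bsub>reduced_homology X p\<^esub>"
  shows "c \<in> carrier (chain_group X p)" "c \<notin> boundaries X p"
  using assms class_eq_one_iff[OF assms(1)] by (auto simp: represents_def cycles_def)

lemma cycles_mono: "X \<subseteq> Y \<Longrightarrow> cycles X p \<subseteq> cycles Y p"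
  by (auto simp: cycles_def chain_group_def simplices_def)

section \<open>Separating a chain from a subgroup\<close>

text \<open>A basis of the subgroup \<open>B\<close>, which is a subspace over the two-element field, stays independent
  when \<open>z\<close> is added to it, so a functional can be prescribed to be \<open>0\<close> on the basis and \<open>1\<close> at \<open>z\<close>.
  Complexes may be infinite, and then this step rests on the axiom of choice.\<close>

lemma exists_separating_functional:
  fixes B :: "('k \<Rightarrow>\<^sub>0 bit) set"
  assumes "0 \<in> B" "\<And>x y. x \<in> B \<Longrightarrow> y \<in> B \<Longrightarrow> x + y \<in> B" "z \<notin> B"
  obtains f :: "('k \<Rightarrow>\<^sub>0 bit) \<Rightarrow> bit"
  where "\<And>x y. f (x + y) = f x + f y" "\<And>x. x \<in> B \<Longrightarrow> f x = 0" "f z = 1"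
proof -
  define scale where "scale a x = (if a = 0 then 0 else x)" for a :: bit and x :: "'k \<Rightarrow>\<^sub>0 bit"
  interpret vector_space_pair scale "(*) :: bit \<Rightarrow> bit \<Rightarrow> bit"
    by unfold_locales (auto simp: scale_def chain_add_self algebra_simps)
  have B: "vs1.subspace B"
    using assms(1,2) by (auto simp: vs1.subspace_def scale_def)
  obtain A where A: "A \<subseteq> B" "vs1.independent A" "B \<subseteq> vs1.span A"
    by (rule vs1.maximal_independent_subset)
  have "vs1.span A \<subseteq> B" by (rule vs1.span_minimal[OF A(1) B])
  then have z: "z \<notin> vs1.span A" using assms(3) by blast
  then have "vs1.independent (insert z A)" using A(2) by (simp add: vs1.independent_insertI)
  from linear_independent_extend[OF this, of "\<lambda>x. if x = z then 1 else 0"]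
  obtain f where f: "Vector_Spaces.linear scale (*) f"
    "\<forall>x\<in>insert z A. f x = (if x = z then 1 else 0)" by blast
  show thesis
  proof
    show "f (x + y) = f x + f y" for x y
      using f(1) by (rule linear_add)
    show "f z = 1" using f(2) by simp
    have "f x = 0" if "x \<in> A" for x
      using f(2) that z vs1.span_base by auto
    then show "f x = 0" if "x \<in> B" for x
      using linear_eq_0_on_span[OF f(1)] A(3) that by blast
  qed
qed

section \<open>Slicing chains of a join\<close>

text \<open>The slant product with the cochain \<open>g\<close>, where \<open>V\<close> is the vertex set of the first factor of the
  join: \<open>\<sigma> * \<tau>\<close> is sent to \<open>g(\<tau>) \<sigma>\<close>.\<close>

definition slice :: "'a set \<Rightarrow> ('a set \<Rightarrow> bit) \<Rightarrow> 'a mod2_chain \<Rightarrow> 'a mod2_chain" where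
  "slice V g = additive_extension (\<lambda>\<rho>. Poly_Mapping.single (\<rho> \<inter> V) (g (\<rho> - V)))"

lemma slice_single: "slice V g (Poly_Mapping.single \<rho> 1) = Poly_Mapping.single (\<rho> \<inter> V) (g (\<rho> - V))"
  by (simp add: slice_def additive_extension_single)

lemma slice_sum: "slice V g (\<Sum>i\<in>I. c i) = (\<Sum>i\<in>I. slice V g (c i))"
  unfolding slice_def by (rule additive_extension_sum) (rule chain_add_self)

lemma slice_eq: "slice V g c = (\<Sum>\<rho>\<in>Poly_Mapping.keys c. Poly_Mapping.single (\<rho> \<inter> V) (g (\<rho> - V)))"
  by (simp add: slice_def additive_extension_def)

lemma single_sum: "Poly_Mapping.single k (\<Sum>i\<in>I. b i) = (\<Sum>i\<in>I. Poly_Mapping.single k (b i))"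
  using sum_comp_morphism[of "Poly_Mapping.single k" b I] by (simp add: single_add o_def)

text \<open>A face of \<open>\<sigma> * \<tau>\<close> omits a vertex either of \<open>\<sigma>\<close> or of \<open>\<tau>\<close>. The faces of the first kind have the
  same second part \<open>\<tau>\<close> and yield \<open>g(\<tau>) \<partial>\<sigma>\<close>; those of the second kind have the same first part \<open>\<sigma>\<close> and
  yield \<open>\<sigma>\<close> with coefficient \<open>g(\<partial>\<tau>)\<close>, which is \<open>0\<close> by the cocycle condition.\<close>

lemma slice_boundary:
  assumes fin: "\<And>\<rho>. \<rho> \<in> Poly_Mapping.keys c \<Longrightarrow> finite \<rho>"
    and cocycle: "\<And>\<rho>. \<rho> \<in> Poly_Mapping.keys c \<Longrightarrow> (\<Sum>v\<in>\<rho> - V. g (\<rho> - V - {v})) = 0"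
  shows "slice V g (boundary c) = boundary (slice V g c)"
proof -
  have "(\<Sum>v\<in>\<rho>. slice V g (Poly_Mapping.single (\<rho> - {v}) 1)) =
      boundary (Poly_Mapping.single (\<rho> \<inter> V) (g (\<rho> - V)))"
    if \<rho>: "\<rho> \<in> Poly_Mapping.keys c" for \<rho>
  proof -
    let ?s = "\<lambda>v. Poly_Mapping.single ((\<rho> - {v}) \<inter> V) (g (\<rho> - {v} - V))"
    have inside: "?s v = Poly_Mapping.single (\<rho> \<inter> V - {v}) (g (\<rho> - V))" if "v \<in> \<rho> \<inter> V" for v
    proof -
      have "(\<rho> - {v}) \<inter> V = \<rho> \<inter> V - {v}" "\<rho> - {v} - V = \<rho> - V" using that by auto
      then show ?thesis by simp
    qed
    have outside: "?s v = Poly_Mapping.single (\<rho> \<inter> V) (g (\<rho> - V - {v}))" if "v \<in> \<rho> - V" for v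
    proof -
      have "(\<rho> - {v}) \<inter> V = \<rho> \<inter> V" "\<rho> - {v} - V = \<rho> - V - {v}" using that by auto
      then show ?thesis by simp
    qed
    have "(\<Sum>v\<in>\<rho>. ?s v) = (\<Sum>v\<in>\<rho> \<inter> V. ?s v) + (\<Sum>v\<in>\<rho> - V. ?s v)"
      using fin[OF \<rho>] by (rule sum.Int_Diff)
    also have "(\<Sum>v\<in>\<rho> - V. ?s v) = (\<Sum>v\<in>\<rho> - V. Poly_Mapping.single (\<rho> \<inter> V) (g (\<rho> - V - {v})))"
      using outside by (rule sum.cong[OF refl])
    also have "\<dots> = 0"
      using cocycle[OF \<rho>] by (simp flip: single_sum)
    also have "(\<Sum>v\<in>\<rho> \<inter> V. ?s v) = boundary (Poly_Mapping.single (\<rho> \<inter> V) (g (\<rho> - V)))"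
      unfolding boundary_single using inside by (rule sum.cong[OF refl])
    finally show ?thesis by (simp add: slice_single)
  qed
  then show ?thesis
    by (simp add: boundary_def[of c] slice_sum slice_eq[of V g c] boundary_sum)
qed

text \<open>With the empty simplex added, each simplex of the join lies in a union of one simplex of \<open>K\<close> and
  one of \<open>L\<close>, including the simplices of \<open>K\<close> and of \<open>L\<close> themselves. Disjointness of the vertex
  sets makes the two parts those cut out by \<open>\<Union>K\<close>.\<close>

lemma join_simplex_parts:
  assumes "abstract_complex K" "abstract_complex L" "\<Union>K \<inter> \<Union>L = {}"
    and "\<rho> \<in> insert {} (complex_join K L)"
  shows "finite \<rho>" "\<rho> \<inter> \<Union>K \<in> insert {} K" "\<rho> - \<Union>K \<in> insert {} L"
proof -
  have K: "\<sigma> \<in> insert {} K \<Longrightarrow> finite \<sigma>" "\<sigma> \<in> insert {} K \<Longrightarrow> \<sigma>' \<subseteq> \<sigma> \<Longrightarrow> \<sigma>' \<in> insert {} K" for \<sigma> \<sigma>'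
    using assms(1) by (auto simp: abstract_complex_def)
  have L: "\<tau> \<in> insert {} L \<Longrightarrow> finite \<tau>" "\<tau> \<in> insert {} L \<Longrightarrow> \<tau>' \<subseteq> \<tau> \<Longrightarrow> \<tau>' \<in> insert {} L" for \<tau> \<tau>'
    using assms(2) by (auto simp: abstract_complex_def)
  obtain \<sigma> \<tau> where *: "\<sigma> \<in> insert {} K" "\<tau> \<in> insert {} L" "\<rho> \<subseteq> \<sigma> \<union> \<tau>"
    using assms(4) unfolding complex_join_def by blast
  then have sub: "\<sigma> \<subseteq> \<Union>K" "\<tau> \<inter> \<Union>K = {}" using assms(3) by auto
  show "finite \<rho>" using K(1)[OF *(1)] L(1)[OF *(2)] *(3) by (meson finite_Un finite_subset)
  show "\<rho> \<inter> \<Union>K \<in> insert {} K" using sub * by (intro K(2)[OF *(1)]) auto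
  show "\<rho> - \<Union>K \<in> insert {} L" using sub * by (intro L(2)[OF *(2)]) auto
qed

text \<open>If \<open>w * z = \<partial>c\<close>, then slicing by a cocycle \<open>f\<close> with \<open>f(z) = 1\<close> gives \<open>w = \<partial>(slice c)\<close>, contrary to
  the choice of \<open>w\<close>.\<close>

lemma join_chain_not_boundary:
  assumes K: "abstract_complex K" and L: "abstract_complex L" and disj: "\<Union>K \<inter> \<Union>L = {}"
    and w: "w \<in> carrier (chain_group K p)" "w \<notin> boundaries K p"
    and z: "z \<in> carrier (chain_group L q)" "z \<notin> boundaries L q"
  shows "join_chain w z \<notin> boundaries (complex_join K L) (p + q + 1)"
proof
  assume "join_chain w z \<in> boundaries (complex_join K L) (p + q + 1)"
  then obtain c where c: "Poly_Mapping.keys c \<subseteq> simplices (complex_join K L) (p + q + 2)"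
    and wz: "join_chain w z = boundary c"
    by (auto simp: boundaries_def chain_group_def add.assoc)
  obtain f :: "'a mod2_chain \<Rightarrow> bit" where f_add: "\<And>x y. f (x + y) = f x + f y"
    and f_bd: "\<And>x. x \<in> boundaries L q \<Longrightarrow> f x = 0" and fz: "f z = 1"
    using exists_separating_functional[OF zero_in_boundaries add_in_boundaries z(2)] by metis
  have f_sum: "f (\<Sum>i\<in>I. x i) = (\<Sum>i\<in>I. f (x i))" for I :: "'i set" and x
    using sum_comp_morphism[of f x I] f_bd[OF zero_in_boundaries] f_add by (simp add: o_def)
  \<comment> \<open>Simplices of the join have parts of all dimensions; the cutoff keeps those with a
    \<open>q\<close>-dimensional part in \<open>L\<close>, so that slices are chains of one dimension.\<close>
  define g where "g \<tau> = (if int (card \<tau>) = q + 1 then f (Poly_Mapping.single \<tau> 1) else 0)" for \<tau>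
  let ?S = "slice (\<Union>K) g"
  have cocycle: "(\<Sum>v\<in>\<tau>. g (\<tau> - {v})) = 0" if \<tau>: "\<tau> \<in> insert {} L" for \<tau>
  proof -
    have fin: "finite \<tau>" using \<tau> L by (auto simp: abstract_complex_def)
    have g_face: "g (\<tau> - {v}) = (if int (card \<tau>) = q + 2 then f (Poly_Mapping.single (\<tau> - {v}) 1) else 0)"
      if "v \<in> \<tau>" for v
    proof -
      have "int (card \<tau>) = int (card (\<tau> - {v})) + 1"
        using card_Suc_Diff1[OF fin that] by linarith
      then show ?thesis by (simp only: g_def) simp
    qed
    show ?thesis
    proof (cases "int (card \<tau>) = q + 2")
      case True
      have "Poly_Mapping.single \<tau> 1 \<in> carrier (chain_group L (q + 1))"
        using True \<tau> by (auto simp: chain_group_def simplices_def)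
      then have "f (boundary (Poly_Mapping.single \<tau> 1)) = 0"
        by (intro f_bd) (simp add: boundaries_def)
      then show ?thesis
        using True by (simp add: boundary_single f_sum g_face)
    next
      case False
      then show ?thesis by (intro sum.neutral) (simp add: g_face)
    qed
  qed
  have parts: "finite \<rho>" "\<rho> \<inter> \<Union>K \<in> insert {} K" "\<rho> - \<Union>K \<in> insert {} L"
    "int (card \<rho>) = p + q + 3" if "\<rho> \<in> Poly_Mapping.keys c" for \<rho>
    using that c join_simplex_parts[OF K L disj, of \<rho>] by (auto simp: simplices_def)
  have "?S (join_chain w z) = w"
  proof -
    have "?S (Poly_Mapping.single (\<sigma> \<union> \<tau>) 1) = Poly_Mapping.single \<sigma> (f (Poly_Mapping.single \<tau> 1))"
      if "\<sigma> \<in> Poly_Mapping.keys w" "\<tau> \<in> Poly_Mapping.keys z" for \<sigma> \<tau>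
    proof -
      have \<sigma>: "\<sigma> \<in> insert {} K" and \<tau>: "\<tau> \<in> insert {} L" "int (card \<tau>) = q + 1"
        using that w(1) z(1) by (auto simp: chain_group_def simplices_def)
      have "(\<sigma> \<union> \<tau>) \<inter> \<Union>K = \<sigma>" "(\<sigma> \<union> \<tau>) - \<Union>K = \<tau>" using \<sigma> \<tau> disj by auto
      then show ?thesis by (simp add: slice_single g_def \<tau>)
    qed
    then have "?S (join_chain w z) = (\<Sum>\<sigma>\<in>Poly_Mapping.keys w. \<Sum>\<tau>\<in>Poly_Mapping.keys z.
        Poly_Mapping.single \<sigma> (f (Poly_Mapping.single \<tau> 1)))"
      by (simp add: join_chain_def slice_sum)
    also have "\<dots> = (\<Sum>\<sigma>\<in>Poly_Mapping.keys w. Poly_Mapping.single \<sigma> (f z))"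
      by (simp only: single_sum[symmetric] f_sum[symmetric] chain_eq_sum_of_keys)
    also have "\<dots> = w" by (simp add: fz chain_eq_sum_of_keys)
    finally show ?thesis .
  qed
  moreover have "?S (boundary c) = boundary (?S c)"
    using parts cocycle by (intro slice_boundary) auto
  moreover have "?S c \<in> carrier (chain_group K (p + 1))"
  proof -
    have "Poly_Mapping.keys (Poly_Mapping.single (\<rho> \<inter> \<Union>K) (g (\<rho> - \<Union>K))) \<subseteq> simplices K (p + 1)"
      if \<rho>: "\<rho> \<in> Poly_Mapping.keys c" for \<rho>
    proof (cases "g (\<rho> - \<Union>K) = 0")
      case False
      then have "int (card (\<rho> - \<Union>K)) = q + 1" by (auto simp: g_def split: if_splits)
      moreover have "card \<rho> = card (\<rho> \<inter> \<Union>K) + card (\<rho> - \<Union>K)"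
        using parts(1)[OF \<rho>] by (metis Int_Diff_disjoint Int_Diff_Un card_Un_disjoint finite_Diff finite_Int)
      ultimately show ?thesis
        using parts[OF \<rho>] by (auto simp: simplices_def)
    qed simp
    then have "Poly_Mapping.keys (?S c) \<subseteq> simplices K (p + 1)"
      unfolding slice_eq using keys_sum[of "\<lambda>\<rho>. Poly_Mapping.single (\<rho> \<inter> \<Union>K) (g (\<rho> - \<Union>K))"] by blast
    then show ?thesis by (simp add: chain_group_def)
  qed
  ultimately have "w \<in> boundaries K p"
    unfolding boundaries_def by (intro image_eqI[of _ _ "?S c"]) (simp_all add: wz)
  then show False using w(2) by simp
qed

lemma join_class_nontrivial:
  assumes "abstract_complex K" "abstract_complex L" "\<Union>K \<inter> \<Union>L = {}" "M \<subseteq> complex_join K L"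
    and "\<alpha> \<noteq> \<one>\<^bsub>reduced_homology K p\<^esub>" "\<beta> \<noteq> \<one>\<^bsub>reduced_homology L q\<^esub>"
    and "represents K p w \<alpha>" "represents L q z \<beta>"
    and "represents_nontrivial M (p + q + 1) (join_chain w z)"
  shows "represents_nontrivial (complex_join K L) (p + q + 1)
           (chain_inclusion M (p + q + 1) (join_chain w z))"
proof -
  have cyc: "join_chain w z \<in> cycles M (p + q + 1)"
    using assms(9) by (simp add: represents_nontrivial_iff)
  then have "chain_inclusion M (p + q + 1) (join_chain w z) = join_chain w z"
    by (simp add: chain_inclusion_def cycles_def)
  moreover have "join_chain w z \<notin> boundaries (complex_join K L) (p + q + 1)"
    using nontrivial_representative[OF assms(7,5)] nontrivial_representative[OF assms(8,6)]
    by (intro join_chain_not_boundary assms(1-3))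
  ultimately show ?thesis
    using cyc cycles_mono[OF assms(4)] by (auto simp: represents_nontrivial_iff)
qed

section \<open>Vertex schemes of geometric complexes\<close>

text \<open>A common point of the two hulls would be an affine combination of \<open>T\<close> and of \<open>S - T\<close>. The
  difference of the two combinations is an affine dependence of \<open>S\<close>, nonzero since its coefficients
  on \<open>T\<close> add up to \<open>1\<close>. This argument uses finite sums only and so holds in a real vector space
  without topology or finite dimension.\<close>

lemma affine_hull_disjoint_opposite_face:
  fixes S :: "'a::real_vector set"
  assumes "\<not> affine_dependent S" "finite S" "T \<subseteq> S"
  shows "affine hull T \<inter> convex hull (S - T) = {}"
proof (rule ccontr)
  assume "affine hull T \<inter> convex hull (S - T) \<noteq> {}"
  then obtain x where x: "x \<in> affine hull T" "x \<in> affine hull (S - T)"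
    using convex_hull_subset_affine_hull by blast
  have fin: "finite T" "finite (S - T)" using assms finite_subset by auto
  obtain a where a: "sum a T = 1" "(\<Sum>v\<in>T. a v *\<^sub>R v) = x"
    using x(1) by (auto simp: affine_hull_finite[OF fin(1)])
  obtain b where b: "sum b (S - T) = 1" "(\<Sum>v\<in>S - T. b v *\<^sub>R v) = x"
    using x(2) by (auto simp: affine_hull_finite[OF fin(2)])
  define c where "c v = (if v \<in> T then a v else - b v)" for v
  have c: "sum c T = 1" "sum c (S - T) = -1"
    "(\<Sum>v\<in>T. c v *\<^sub>R v) = x" "(\<Sum>v\<in>S - T. c v *\<^sub>R v) = - x"
    using a b by (simp_all add: c_def sum_negf)
  have "sum c S = 0"
    using sum.subset_diff[OF assms(3,2), of c] c by simp
  moreover have "(\<Sum>v\<in>S. c v *\<^sub>R v) = 0"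
    using sum.subset_diff[OF assms(3,2), of "\<lambda>v. c v *\<^sub>R v"] c by simp
  moreover have "\<exists>v\<in>S. c v \<noteq> 0"
  proof (rule ccontr)
    assume "\<not> (\<exists>v\<in>S. c v \<noteq> 0)"
    then have "sum c T = 0" using assms(3) by (intro sum.neutral) auto
    then show False using c(1) by simp
  qed
  ultimately show False
    using assms(1) affine_dependent_explicit_finite[OF assms(2)] by blast
qed

lemma subset_hull_face:
  fixes S :: "'a::real_vector set"
  assumes "\<not> affine_dependent S" "finite S" "T \<subseteq> S"
  shows "convex hull T face_of convex hull S"
  using assms by (intro face_of_convex_hulls affine_hull_disjoint_opposite_face)

lemma vertices_convex_hull:
  fixes V :: "'a::real_vector set"
  assumes "\<not> affine_dependent V" "finite V"
  shows "vertices (convex hull V) = V"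
proof
  show "vertices (convex hull V) \<subseteq> V"
    using extreme_point_of_convex_hull by (auto simp: vertices_def)
  show "V \<subseteq> vertices (convex hull V)"
  proof
    fix v assume "v \<in> V"
    then have "convex hull {v} face_of convex hull V"
      using assms by (intro subset_hull_face) auto
    then show "v \<in> vertices (convex hull V)"
      by (simp add: vertices_def face_of_singleton)
  qed
qed

lemma geometric_simplex_vertices:
  assumes "geometric_complex K" "S \<in> K"
  shows "finite (vertices S)" "vertices S \<noteq> {}" "\<not> affine_dependent (vertices S)"
    "convex hull (vertices S) = S"
proof -
  obtain V where "finite V" "V \<noteq> {}" "\<not> affine_dependent V" "S = convex hull V"
    using bspec[OF conjunct1[OF assms(1)[unfolded geometric_complex_def]] assms(2)] by blast
  then show "finite (vertices S)" "vertices S \<noteq> {}" "\<not> affine_dependent (vertices S)"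
    "convex hull (vertices S) = S"
    using vertices_convex_hull[of V] by simp_all
qed

text \<open>A subset of the vertices of a simplex spans a face, faces of simplices of \<open>K\<close> lie in \<open>K\<close>, and the
  subset is recovered as the vertex set of that face.\<close>

lemma abstract_complex_vertex_scheme:
  assumes "geometric_complex K"
  shows "abstract_complex (vertex_scheme K)"
  unfolding abstract_complex_def vertex_scheme_def
proof (intro conjI ballI allI impI)
  fix \<sigma> assume "\<sigma> \<in> vertices ` K"
  then obtain S where S: "S \<in> K" "\<sigma> = vertices S" by blast
  then show "finite \<sigma>" "\<sigma> \<noteq> {}" using geometric_simplex_vertices[OF assms] by auto
  fix \<rho> assume \<rho>: "\<rho> \<subseteq> \<sigma> \<and> \<rho> \<noteq> {}"
  have ind: "\<not> affine_dependent \<sigma>" "finite \<sigma>" "convex hull \<sigma> = S"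
    using S geometric_simplex_vertices[OF assms] by auto
  have "convex hull \<rho> face_of S" "convex hull \<rho> \<noteq> {}"
    using \<rho> subset_hull_face[OF ind(1,2), of \<rho>] by (simp_all add: ind(3))
  then have "convex hull \<rho> \<in> K"
    using assms S(1) unfolding geometric_complex_def by blast
  moreover have "vertices (convex hull \<rho>) = \<rho>"
    using \<rho> ind by (intro vertices_convex_hull) (auto dest: affine_dependent_subset finite_subset)
  ultimately show "\<rho> \<in> vertices ` K" by (metis imageI)
qed

text \<open>The geometric join consists of the convex hulls of the members of the abstract join. Each member
  is contained in an affinely independent set, either the vertices of one simplex of \<open>K\<close> or \<open>L\<close>, or
  the union of the vertices of two, so taking vertices undoes the convex hull.\<close>

lemma vertex_scheme_geometric_join:
  assumes K: "geometric_complex K" and L: "geometric_complex L" and ex: "geometric_join_exists K L"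
  shows "vertex_scheme (geometric_join K L) = complex_join (vertex_scheme K) (vertex_scheme L)"
proof -
  have "vertices (convex hull \<rho>) = \<rho>"
    if \<rho>: "\<rho> \<in> complex_join (vertex_scheme K) (vertex_scheme L)" for \<rho>
  proof -
    have "\<exists>\<upsilon>. \<not> affine_dependent \<upsilon> \<and> finite \<upsilon> \<and> \<rho> \<subseteq> \<upsilon>"
      using \<rho> unfolding complex_join_def vertex_scheme_def
    proof (elim UnE)
      assume "\<rho> \<in> vertices ` K"
      then show ?thesis using geometric_simplex_vertices[OF K] by blast
    next
      assume "\<rho> \<in> vertices ` L"
      then show ?thesis using geometric_simplex_vertices[OF L] by blast
    next
      assume "\<rho> \<in> {\<rho>. \<rho> \<noteq> {} \<and> (\<exists>\<sigma>\<in>vertices ` K. \<exists>\<tau>\<in>vertices ` L. \<rho> \<subseteq> \<sigma> \<union> \<tau>)}"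
      then obtain S T where "S \<in> K" "T \<in> L" "\<rho> \<subseteq> vertices S \<union> vertices T" by blast
      moreover from this have "finite (vertices S)" "finite (vertices T)"
        by (simp_all add: geometric_simplex_vertices[OF K] geometric_simplex_vertices[OF L])
      moreover have "\<not> affine_dependent (vertices S \<union> vertices T)"
        using ex \<open>S \<in> K\<close> \<open>T \<in> L\<close> by (simp add: geometric_join_exists_def)
      ultimately show ?thesis by blast
    qed
    then show ?thesis
      by (metis affine_dependent_subset finite_subset vertices_convex_hull)
  qed
  then show ?thesis
    unfolding vertex_scheme_def geometric_join_def image_image by simp
qed

section \<open>The theorem for abstract and geometric joins\<close>

theorem theorem1p2:
  fixes p q :: int
  assumes "p \<ge> 0" and "q \<ge> 0"
  shows
    "(\<forall>(K :: 'a set set) L M \<alpha> \<beta> w z.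
        abstract_complex K \<and> abstract_complex L \<and> \<Union>K \<inter> \<Union>L = {} \<and>
        abstract_complex M \<and> M \<subseteq> complex_join K L \<and>
        \<alpha> \<in> carrier (reduced_homology K p) \<and> \<alpha> \<noteq> \<one>\<^bsub>reduced_homology K p\<^esub> \<and>
        \<beta> \<in> carrier (reduced_homology L q) \<and> \<beta> \<noteq> \<one>\<^bsub>reduced_homology L q\<^esub> \<and>
        represents K p w \<alpha> \<and> represents L q z \<beta> \<and>
        join_chain w z \<in> carrier (chain_group M (p + q + 1)) \<and>
        represents_nontrivial M (p + q + 1) (join_chain w z)
        \<longrightarrow> represents_nontrivial (complex_join K L) (p + q + 1)
              (chain_inclusion M (p + q + 1) (join_chain w z))) \<and>
     (\<forall>(K :: 'b::real_vector set set) L M \<alpha> \<beta> w z.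
        geometric_complex K \<and> geometric_complex L \<and>
        \<Union>(vertex_scheme K) \<inter> \<Union>(vertex_scheme L) = {} \<and> geometric_join_exists K L \<and>
        geometric_complex M \<and> M \<subseteq> geometric_join K L \<and>
        \<alpha> \<in> carrier (reduced_homology (vertex_scheme K) p) \<and>
        \<alpha> \<noteq> \<one>\<^bsub>reduced_homology (vertex_scheme K) p\<^esub> \<and>
        \<beta> \<in> carrier (reduced_homology (vertex_scheme L) q) \<and>
        \<beta> \<noteq> \<one>\<^bsub>reduced_homology (vertex_scheme L) q\<^esub> \<and>
        represents (vertex_scheme K) p w \<alpha> \<and> represents (vertex_scheme L) q z \<beta> \<and>
        join_chain w z \<in> carrier (chain_group (vertex_scheme M) (p + q + 1)) \<and>
        represents_nontrivial (vertex_scheme M) (p + q + 1) (join_chain w z)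
        \<longrightarrow> represents_nontrivial (vertex_scheme (geometric_join K L)) (p + q + 1)
              (chain_inclusion (vertex_scheme M) (p + q + 1) (join_chain w z)))"
proof (intro conjI allI impI; elim conjE)
  fix K L M :: "'a set set" and \<alpha> \<beta> w z
  assume "abstract_complex K" "abstract_complex L" "\<Union>K \<inter> \<Union>L = {}" "M \<subseteq> complex_join K L"
    "\<alpha> \<noteq> \<one>\<^bsub>reduced_homology K p\<^esub>" "\<beta> \<noteq> \<one>\<^bsub>reduced_homology L q\<^esub>"
    "represents K p w \<alpha>" "represents L q z \<beta>"
    "represents_nontrivial M (p + q + 1) (join_chain w z)"
  then show "represents_nontrivial (complex_join K L) (p + q + 1)
      (chain_inclusion M (p + q + 1) (join_chain w z))"
    by (rule join_class_nontrivial)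
next
  fix K L M :: "'b set set" and \<alpha> \<beta> w z
  assume K: "geometric_complex K" and L: "geometric_complex L"
    and disj: "\<Union>(vertex_scheme K) \<inter> \<Union>(vertex_scheme L) = {}"
    and ex: "geometric_join_exists K L" and M: "M \<subseteq> geometric_join K L"
    and classes: "\<alpha> \<noteq> \<one>\<^bsub>reduced_homology (vertex_scheme K) p\<^esub>"
      "\<beta> \<noteq> \<one>\<^bsub>reduced_homology (vertex_scheme L) q\<^esub>"
      "represents (vertex_scheme K) p w \<alpha>" "represents (vertex_scheme L) q z \<beta>"
      "represents_nontrivial (vertex_scheme M) (p + q + 1) (join_chain w z)"
  have "vertex_scheme M \<subseteq> vertex_scheme (geometric_join K L)"
    using M unfolding vertex_scheme_def by (rule image_mono)
  then show "represents_nontrivial (vertex_scheme (geometric_join K L)) (p + q + 1)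
      (chain_inclusion (vertex_scheme M) (p + q + 1) (join_chain w z))"
    unfolding vertex_scheme_geometric_join[OF K L ex]
    using classes
    by (intro join_class_nontrivial[OF abstract_complex_vertex_scheme[OF K]
          abstract_complex_vertex_scheme[OF L] disj])
qed

end
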